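(* Let $X$ and $Y$ be infinite compact spaces, $Z$ a metrizable space, and $K$ a compact subspace of $S(X\times Y,Z)$. Then $w(K)<\min\{c^\sharp(X),c^\sharp(Y)\}$.
   Context: All compact spaces are assumed Hausdorff. For topological spaces $X,Y,Z$, a function $f:X\times Y\to Z$ is separately continuous if $y\mapsto f(x,y)$ is continuous for every $x\in X$ and $x\mapsto f(x,y)$ is continuous for every $y\in Y$. $S(X\times Y,Z)$ denotes the set of all separately continuous functions $X\times Y\to Z$. For $p=(a,b)\in X\times Y$, the cross of $p$ is $\mathrm{cr}\{p\}=(\{a\}\times Y)\cup(X\times\{b\})$. For $X,Y$ compact and $Z$ metrizable with a compatible metric $d$, $S(X\times Y,Z)$ carries the topology generated by the family of extended pseudometrics $d_c(s,t)=\sup_{p\in\mathrm{cr}\{c\}} d(s(p),t(p))$, $c\in X\times Y$ (the cross-uniform topology); it coincides with the cross-open topology, generated by the subbase of sets $\{s: s(A)\subseteq W\}$ with $W$ open in $Z$ and $A=\overline{G}\cap C$, where $C=\mathrm{cr}\{p\}$ for some $p$ and $G$ is open in $C$. $w(K)$ is the weight of $K$. The sharp cellularity is $c^\sharp(X)=\sup\{|\mathcal U|^+:\mathcal U$ a family of pairwise disjoint open sets in $X\}$, where $\mathfrak m^+$ denotes the least cardinal greater than $\mathfrak m$. *)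

theory Defs
  imports "HOL-Analysis.Analysis"
begin

definition sep_cont :: "'a topology \<Rightarrow> 'b topology \<Rightarrow> 'c topology \<Rightarrow> ('a \<times> 'b \<Rightarrow> 'c) set" where
  "sep_cont X Y Z = {f. f \<in> extensional (topspace X \<times> topspace Y)
      \<and> (\<forall>x\<in>topspace X. continuous_map Y Z (\<lambda>y. f (x, y)))
      \<and> (\<forall>y\<in>topspace Y. continuous_map X Z (\<lambda>x. f (x, y)))}"

definition cross :: "'a topology \<Rightarrow> 'b topology \<Rightarrow> 'a \<times> 'b \<Rightarrow> ('a \<times> 'b) set" where
  "cross X Y p = ({fst p} \<times> topspace Y) \<union> (topspace X \<times> {snd p})"

definition cross_open_topology ::
  "'a topology \<Rightarrow> 'b topology \<Rightarrow> 'c topology \<Rightarrow> ('a \<times> 'b \<Rightarrow> 'c) topology" where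
  "cross_open_topology X Y Z = topology_generated_by
     {{s \<in> sep_cont X Y Z. s ` A \<subseteq> W} | A W. openin Z W \<and>
        (\<exists>p G. p \<in> topspace X \<times> topspace Y \<and>
           openin (subtopology (prod_topology X Y) (cross X Y p)) G \<and>
           A = (prod_topology X Y) closure_of G \<inter> cross X Y p)}"

definition is_base :: "'a topology \<Rightarrow> 'a set set \<Rightarrow> bool" where
  "is_base T B \<longleftrightarrow> (\<forall>b\<in>B. openin T b) \<and>
     (\<forall>U. openin T U \<longrightarrow> (\<exists>C\<subseteq>B. \<Union>C = U))"

definition disjoint_open_family :: "'a topology \<Rightarrow> 'a set set \<Rightarrow> bool" where
  "disjoint_open_family X U \<longleftrightarrow> (\<forall>u\<in>U. openin X u \<and> u \<noteq> {}) \<and> pairwise disjnt U"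

text \<open>r <o c#(X), where c#(X) = sup{ |U|^+ : U disjoint open family}; since a cardinal
  is below a supremum of cardinals iff it is below one of them, this unfolds to:\<close>
definition less_sharp_cellularity :: "'r rel \<Rightarrow> 'a topology \<Rightarrow> bool" where
  "less_sharp_cellularity r X \<longleftrightarrow>
     (\<exists>U. disjoint_open_family X U \<and> ordLess2 r (cardSuc (card_of U)))"

text \<open>w(T) < c#(X): the minimum cardinality of a base is below c#(X),
  i.e. some base has cardinality below c#(X).\<close>
definition weight_less_sharp_cellularity :: "'f topology \<Rightarrow> 'a topology \<Rightarrow> bool" where
  "weight_less_sharp_cellularity T X \<longleftrightarrow>
     (\<exists>B. is_base T B \<and> less_sharp_cellularity (card_of B) X)"

end

theory Submission
  imports Defs
begin

unbundle cardinal_syntax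

text \<open>
  On a compact set \<open>K\<close> of separately continuous functions, the functions \<open>s\<close> are equicontinuous along each
  cross, so \<open>g x y = (\<lambda>s. s (x, y))\<close> is a separately continuous map from \<open>X \<times> Y\<close> to the metric space
  \<open>C(K, Z)\<close> with the uniform metric. By Namioka's theorem every nonempty open subset of \<open>X\<close> contains a
  nonempty open \<open>H\<close> on which all the maps \<open>\<lambda>x. g x y\<close> oscillate by less than \<open>1/n\<close>. A maximal disjoint family \<open>W n\<close> of
  such sets has a dense union, so picking one point in each member, and then a finite net in the compact
  \<open>Y\<close>, yields a dense subset of the range of \<open>g\<close>. The theorem of Erdos and Tarski provides a single
  disjoint open family at least as large as the union of all the \<open>W n\<close>. The evaluations at the points of the dense set
  separate the points of the compact space \<open>K\<close>, hence they determine a base of no larger cardinality. The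
  argument is symmetric in \<open>X\<close> and \<open>Y\<close>.
\<close>


subsection \<open>Disjoint families of open sets\<close>

text \<open>An infinite open set \<open>W\<close> can always be split: either removing the closure
  of a neighbourhood \<open>A\<close> of one point leaves infinitely many points, or a second point
  \<open>b\<close> has a finite neighbourhood and is therefore isolated, so that \<open>{b}\<close>
  can be split off. Repeating the splitting inside the infinite remainder gives the family.\<close>

lemma exists_infinite_disjoint_open_family:
  assumes "Hausdorff_space X" "infinite (topspace X)"
  shows "\<exists>V. disjoint_open_family X V \<and> infinite V"
proof -
  define P where "P p \<longleftrightarrow> openin X (fst p) \<and> fst p \<noteq> {} \<and> openin X (snd p) \<and> infinite (snd p)
      \<and> disjnt (fst p) (snd p)" for p :: "'a set \<times> 'a set"
  have step: "\<exists>p. P p \<and> fst p \<subseteq> W \<and> snd p \<subseteq> W" if W: "openin X W" "infinite W" for W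
  proof -
    obtain a where a: "a \<in> W" using W(2) infinite_imp_nonempty by blast
    obtain b where b: "b \<in> W" "b \<noteq> a"
      using infinite_imp_nonempty[OF infinite_remove[OF W(2), of a]] by blast
    obtain A B where AB: "openin X A" "openin X B" "a \<in> A" "b \<in> B" "disjnt A B"
      by (metis assms(1) Hausdorff_space_def W(1) a b openin_subset subsetD)
    show ?thesis
    proof (cases "finite (W - X closure_of A)")
      case False
      have "openin X (W - X closure_of A)" using W(1) by (simp add: openin_diff)
      moreover have "disjnt (A \<inter> W) (W - X closure_of A)"
        using closure_of_subset[OF openin_subset[OF AB(1)]] by (auto simp: disjnt_iff)
      ultimately have "P (A \<inter> W, W - X closure_of A)"
        using False AB W a by (auto simp: P_def)
      then show ?thesis by force
    next
      case True
      have "B \<inter> X closure_of A = {}"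
        using AB openin_Int_closure_of_eq_empty by (metis disjnt_def inf_commute)
      then have "B \<inter> W \<subseteq> W - X closure_of A" by blast
      then have fin: "finite (B \<inter> W)" using True finite_subset by blast
      have "openin X (B \<inter> W - (B \<inter> W - {b}))"
      proof (intro openin_diff openin_Int AB W closedin_Hausdorff_finite assms)
        show "B \<inter> W - {b} \<subseteq> topspace X" using openin_subset[OF W(1)] by auto
      qed (use fin in auto)
      moreover have "B \<inter> W - (B \<inter> W - {b}) = {b}" using AB b by auto
      moreover have "openin X (W - {b})"
        by (simp add: assms(1) W(1) open_in_Hausdorff_delete)
      ultimately have "P ({b}, W - {b})"
        using W by (auto simp: P_def)
      then show ?thesis using b by force
    qed
  qed
  obtain f where f: "\<And>n. P (f n)" "\<And>n. fst (f (Suc n)) \<subseteq> snd (f n) \<and> snd (f (Suc n)) \<subseteq> snd (f n)"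
  proof (rule exE[OF dependent_nat_choice[of "\<lambda>_. P" "\<lambda>_ p q. fst q \<subseteq> snd p \<and> snd q \<subseteq> snd p"]])
    show "\<exists>p. P p" using step[OF openin_topspace assms(2)] by blast
    show "\<exists>q. P q \<and> fst q \<subseteq> snd p \<and> snd q \<subseteq> snd p" if "P p" for p
      using step[of "snd p"] that by (auto simp: P_def)
  qed blast
  have dec: "snd (f n) \<subseteq> snd (f m)" if "m \<le> n" for m n
    using that by (induction rule: dec_induct) (use f(2) in auto)
  have disj: "disjnt (fst (f m)) (fst (f n))" if "m < n" for m n
  proof -
    have "fst (f n) \<subseteq> snd (f m)"
      using that dec[of m "n - 1"] f(2)[of "n - 1"] by (cases n) auto
    then show ?thesis using f(1)[of m] by (auto simp: P_def disjnt_iff)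
  qed
  have disj': "disjnt (fst (f m)) (fst (f n))" if "m \<noteq> n" for m n
    using disj[of m n] disj[of n m] that disjnt_sym by (metis nat_neq_iff)
  have "inj (\<lambda>n. fst (f n))"
  proof (rule injI, rule ccontr)
    fix m n assume "fst (f m) = fst (f n)" "m \<noteq> n"
    with disj'[of m n] f(1)[of m] show False by (auto simp: P_def)
  qed
  then have "infinite (range (\<lambda>n. fst (f n)))" by (simp add: finite_image_iff)
  moreover have "disjoint_open_family X (range (\<lambda>n. fst (f n)))"
    unfolding disjoint_open_family_def pairwise_def
  proof (intro conjI ballI impI)
    fix u v assume "u \<in> range (\<lambda>n. fst (f n))" "v \<in> range (\<lambda>n. fst (f n))" "u \<noteq> v"
    then obtain i j where ij: "u = fst (f i)" "v = fst (f j)" by (elim rangeE)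
    with \<open>u \<noteq> v\<close> have "i \<noteq> j" by blast
    then show "disjnt u v" using disj'[of i j] ij by simp
  next
    fix u assume "u \<in> range (\<lambda>n. fst (f n))"
    then obtain i where "u = fst (f i)" by (elim rangeE)
    then show "openin X u" "u \<noteq> {}" using f(1)[of i] by (auto simp: P_def)
  qed
  ultimately show ?thesis by blast
qed

text \<open>Zorn's lemma. If an open \<open>G\<close> missed every member of a maximal family, a set
  \<open>H\<close> inside \<open>G\<close> with property \<open>P\<close> could be added. The last
  conjunct says that the union of the family is dense.\<close>

lemma maximal_disjoint_open_family:
  assumes "\<And>G. openin X G \<Longrightarrow> G \<noteq> {} \<Longrightarrow> \<exists>H\<subseteq>G. openin X H \<and> H \<noteq> {} \<and> P H"
  shows "\<exists>W. disjoint_open_family X W \<and> (\<forall>H\<in>W. P H) \<and>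
    (\<forall>G. openin X G \<longrightarrow> G \<noteq> {} \<longrightarrow> (\<exists>H\<in>W. G \<inter> H \<noteq> {}))"
proof -
  define \<A> where "\<A> = {W. disjoint_open_family X W \<and> (\<forall>H\<in>W. P H)}"
  have "\<exists>M\<in>\<A>. \<forall>W\<in>\<A>. M \<subseteq> W \<longrightarrow> W = M"
  proof (rule subset_Zorn_nonempty)
    show "\<A> \<noteq> {}" by (auto simp: \<A>_def disjoint_open_family_def intro!: exI[of _ "{}"])
    fix \<C> assume \<C>: "\<C> \<noteq> {}" "subset.chain \<A> \<C>"
    then have "pairwise disjnt (\<Union>\<C>)"
      using pairwise_chain_Union[of \<C> disjnt]
      by (auto simp: \<A>_def disjoint_open_family_def subset_chain_def chain_subset_def)
    then show "\<Union>\<C> \<in> \<A>"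
      using \<C> by (auto simp: \<A>_def disjoint_open_family_def subset_chain_def)
  qed
  then obtain M where M: "M \<in> \<A>" "\<And>W. W \<in> \<A> \<Longrightarrow> M \<subseteq> W \<Longrightarrow> W = M" by blast
  have "\<exists>H\<in>M. G \<inter> H \<noteq> {}" if G: "openin X G" "G \<noteq> {}" for G
  proof (rule ccontr)
    assume none: "\<not> ?thesis"
    obtain H where H: "H \<subseteq> G" "openin X H" "H \<noteq> {}" "P H" using assms[OF G] by blast
    then have "disjnt H H'" if "H' \<in> M" for H' using none that by (auto simp: disjnt_def)
    then have "insert H M \<in> \<A>"
      using H M(1) by (auto simp: \<A>_def disjoint_open_family_def pairwise_insert disjnt_sym)
    with M(2)[of "insert H M"] have "H \<in> M" by blast
    with none H show False by blast
  qed
  with M(1) show ?thesis by (auto simp: \<A>_def)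
qed

lemma disjoint_open_family_UNION:
  assumes "disjoint_open_family X W"
    and "\<And>H. H \<in> W \<Longrightarrow> disjoint_open_family X (V H)"
    and "\<And>H v. H \<in> W \<Longrightarrow> v \<in> V H \<Longrightarrow> v \<subseteq> H"
  shows "disjoint_open_family X (\<Union>H\<in>W. V H)"
proof -
  have "disjnt u v" if "H \<in> W" "H' \<in> W" "u \<in> V H" "v \<in> V H'" "u \<noteq> v" for H H' u v
  proof (cases "H = H'")
    case True
    then show ?thesis
      using assms(2)[of H] that by (auto simp: disjoint_open_family_def pairwise_def)
  next
    case False
    then have "disjnt H H'"
      using assms(1) that by (auto simp: disjoint_open_family_def pairwise_def)
    then show ?thesis
      using assms(3)[of H u] assms(3)[of H' v] that by (auto simp: disjnt_iff)
  qed
  then show ?thesis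
    using assms(2) by (auto simp: disjoint_open_family_def pairwise_def)
qed

section \<open>The theorem of Erdos and Tarski for countably many families\<close>

text \<open>The cardinality of the union may be a supremum of countable cofinality that no single
  \<open>U n\<close> reaches. It is reached by placing families of increasing size inside pairwise
  disjoint open sets and taking their union. Infinity of \<open>V\<close> then absorbs the countable
  index set.\<close>

lemma Erdos_Tarski_countable:
  fixes U :: "nat \<Rightarrow> 'a set set"
  assumes V0: "disjoint_open_family X V0" "infinite V0"
    and U: "\<And>n. disjoint_open_family X (U n)"
  shows "\<exists>V. disjoint_open_family X V \<and> infinite V \<and> |\<Union>n. U n| \<le>o |V|"
proof -
  \<comment> \<open>Without loss of generality the cardinalities increase.\<close>
  obtain M where M: "\<And>n. disjoint_open_family X (M n) \<and> infinite (M n)"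
    and M_Suc: "\<And>n. |M n| \<le>o |M (Suc n)| \<and> |U n| \<le>o |M (Suc n)|"
  proof (rule exE[OF dependent_nat_choice[of "\<lambda>_ V. disjoint_open_family X V \<and> infinite V"
          "\<lambda>n V V'. |V| \<le>o |V'| \<and> |U n| \<le>o |V'|"]])
    show "\<exists>V. disjoint_open_family X V \<and> infinite V" using V0 by blast
    show "\<exists>V'. (disjoint_open_family X V' \<and> infinite V') \<and> |V| \<le>o |V'| \<and> |U n| \<le>o |V'|"
      if V: "disjoint_open_family X V \<and> infinite V" for V n
    proof (cases "|V| \<le>o |U n|")
      case True
      then show ?thesis using V U card_of_ordLeq_infinite ordLeq_reflexive card_of_Well_order by blast
    next
      case False
      then have "|U n| \<le>o |V|" using ordLeq_total card_of_Well_order by blast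
      then show ?thesis using V ordLeq_reflexive card_of_Well_order by blast
    qed
  qed blast
  have mono: "|M m| \<le>o |M n|" if "m \<le> n" for m n
    using that by (induction rule: dec_induct)
      (use M_Suc ordLeq_transitive ordLeq_reflexive card_of_Well_order in blast)+
  \<comment> \<open>Either some open set is hereditarily large, or there is a maximal disjoint family \<open>W\<close> of sets that are
    not large for some \<open>n\<close>. If \<open>W\<close> contains \<open>n\<close>-large members for every \<open>n\<close>, each of them serves only finitely
    many \<open>n\<close>; otherwise \<open>|M k|\<close> is at most \<open>|W|\<close> times a fixed \<open>|M N|\<close>.\<close>
  define large where "large n H \<longleftrightarrow>
    (\<exists>V. disjoint_open_family X V \<and> (\<forall>v\<in>V. v \<subseteq> H) \<and> |M n| \<le>o |V| )" for n H
  have large_antimono: "large m H" if "large n H" "m \<le> n" for m n H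
    using that mono[of m n] ordLeq_transitive unfolding large_def by blast
  have combine: "\<exists>V. disjoint_open_family X V \<and> (\<forall>n. |M n| \<le>o |V| )"
    if W: "disjoint_open_family X W" and h: "\<And>n. h n \<in> W" "\<And>n. finite {m. h m = h n}"
      "\<And>n. large n (h n)" for W h
  proof -
    obtain V where V: "\<And>n. disjoint_open_family X (V n)" "\<And>n v. v \<in> V n \<Longrightarrow> v \<subseteq> h n"
        "\<And>n. |M n| \<le>o |V n|"
      using h(3) unfolding large_def by metis
    \<comment> \<open>As \<open>h\<close> need not be injective, one index per set has to be chosen:
      families inside the same set need not be disjoint from each other. The largest index works,
      since its family is at least as large as every \<open>M n\<close> with
      \<open>h n = H\<close>.\<close>
    define last where "last H = Max {m. h m = H}" for H
    have last: "h (last H) = H" if "H \<in> range h" for H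
      using Max_in[of "{m. h m = H}"] that h(2) by (auto simp: last_def)
    have le_last: "n \<le> last (h n)" for n
      using h(2) by (simp add: last_def)
    have "disjoint_open_family X (\<Union>H\<in>range h. V (last H))"
    proof (rule disjoint_open_family_UNION)
      show "disjoint_open_family X (range h)"
        using W h(1) unfolding disjoint_open_family_def
        by (auto intro: pairwise_subset[OF _ image_subsetI])
      show "v \<subseteq> H" if "H \<in> range h" "v \<in> V (last H)" for H v
        using V(2)[OF that(2)] last[OF that(1)] by simp
    qed (rule V)
    moreover have "|M n| \<le>o |\<Union>H\<in>range h. V (last H)|" for n
    proof -
      have "|V (last (h n))| \<le>o |\<Union>H\<in>range h. V (last H)|"
        by (intro card_of_mono1) blast
      then show ?thesis
        using mono[OF le_last] V(3) ordLeq_transitive by blast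
    qed
    ultimately show ?thesis by blast
  qed
  have "\<exists>V. disjoint_open_family X V \<and> (\<forall>n. |M n| \<le>o |V| )"
  proof (cases "\<exists>G. openin X G \<and> G \<noteq> {} \<and> (\<forall>H\<subseteq>G. openin X H \<longrightarrow> H \<noteq> {} \<longrightarrow> (\<forall>n. large n H))")
    case True
    then obtain G where G: "openin X G" "G \<noteq> {}"
      and G_large: "\<forall>H\<subseteq>G. openin X H \<longrightarrow> H \<noteq> {} \<longrightarrow> (\<forall>n. large n H)" by (elim exE conjE)
    then have "large 0 G" by simp
    then obtain W where W: "disjoint_open_family X W" "\<And>v. v \<in> W \<Longrightarrow> v \<subseteq> G" "|M 0| \<le>o |W|"
      unfolding large_def by blast
    \<comment> \<open>The family witnessing \<open>large 0 G\<close> is already infinite, and every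
      member of it is large for all \<open>n\<close>, so any injective sequence of members can be
      passed to \<open>combine\<close>.\<close>
    then have "infinite W" using M card_of_ordLeq_infinite by blast
    then obtain h :: "nat \<Rightarrow> 'a set" where h: "inj h" "range h \<subseteq> W"
      using infinite_countable_subset by blast
    have "{m. h m = h n} = {n}" for n using h(1) by (auto dest: injD)
    moreover have "large n (h n)" for n
    proof -
      have "h n \<in> W" using h(2) by blast
      then show ?thesis using G_large W by (auto simp: disjoint_open_family_def)
    qed
    moreover have "h n \<in> W" for n using h(2) by blast
    ultimately show ?thesis using combine[OF W(1), of h] by simp
  next
    case False
    have small: "\<exists>H\<subseteq>G. openin X H \<and> H \<noteq> {} \<and> (\<exists>n. \<not> large n H)" if "openin X G" "G \<noteq> {}" for G
    proof (rule ccontr)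
      assume "\<not> ?thesis"
      then have "\<forall>H\<subseteq>G. openin X H \<longrightarrow> H \<noteq> {} \<longrightarrow> (\<forall>n. large n H)" by auto
      with that have "\<exists>G. openin X G \<and> G \<noteq> {} \<and> (\<forall>H\<subseteq>G. openin X H \<longrightarrow> H \<noteq> {} \<longrightarrow> (\<forall>n. large n H))"
        by (intro exI[of _ G] conjI)
      with False show False by (rule notE)
    qed
    have "\<exists>W. disjoint_open_family X W \<and> (\<forall>H\<in>W. \<exists>n. \<not> large n H) \<and>
        (\<forall>G. openin X G \<longrightarrow> G \<noteq> {} \<longrightarrow> (\<exists>H\<in>W. G \<inter> H \<noteq> {}))"
      by (rule maximal_disjoint_open_family) (rule small)
    then obtain W where W: "disjoint_open_family X W" "\<forall>H\<in>W. \<exists>n. \<not> large n H"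
      and W_max: "\<forall>G. openin X G \<longrightarrow> G \<noteq> {} \<longrightarrow> (\<exists>H\<in>W. G \<inter> H \<noteq> {})"
      by (elim exE conjE)
    show ?thesis
    proof (cases "\<forall>n. \<exists>H\<in>W. large n H")
      case True
      then obtain h where h: "\<And>n. h n \<in> W" "\<And>n. large n (h n)" by metis
      have "finite {m. h m = h n}" for n
      proof -
        obtain k where k: "\<not> large k (h n)" using W(2) h(1) by blast
        \<comment> \<open>A set that is not large for \<open>k\<close> is not large for any index
          above \<open>k\<close>, so only indices below \<open>k\<close> can be sent to it.\<close>
        have "{m. h m = h n} \<subseteq> {..<k}"
        proof
          fix m assume "m \<in> {m. h m = h n}"
          then have "large m (h n)" using h(2)[of m] by simp
          then show "m \<in> {..<k}" using large_antimono k by (meson lessThan_iff not_le)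
        qed
        then show ?thesis using finite_subset by blast
      qed
      then show ?thesis using combine[OF W(1), of h] h by blast
    next
      case False
      then obtain N where N: "\<And>H. H \<in> W \<Longrightarrow> \<not> large N H" by blast
      show ?thesis
      proof (rule ccontr)
        assume none: "\<not> ?thesis"
        then obtain m where "\<not> |M m| \<le>o |W|" using W(1) by blast
        then have Wm: "|W| \<le>o |M m|" using ordLeq_total card_of_Well_order by blast
        let ?B = "M (max m N)"
        \<comment> \<open>Every member of \<open>M k\<close> meets some \<open>H\<close> in
          \<open>W\<close>, and the traces on one \<open>H\<close> form a disjoint family, so fewer
          than \<open>|M N|\<close> members meet it. Hence \<open>M (max m N)\<close> would itself
          be a family of the desired kind, contradicting \<open>none\<close>.\<close>
        have "|M k| \<le>o |?B|" for k
        proof -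
          have "M k \<subseteq> (\<Union>H\<in>W. {v \<in> M k. v \<inter> H \<noteq> {}})"
            using M[of k] W_max by (fastforce simp: disjoint_open_family_def)
          moreover have "|\<Union>H\<in>W. {v \<in> M k. v \<inter> H \<noteq> {}}| \<le>o |?B|"
          proof (intro card_of_UNION_ordLeq_infinite ballI)
            show "infinite ?B" using M by blast
            show "|W| \<le>o |?B|" using Wm mono[of m "max m N"] ordLeq_transitive by auto
            fix H assume H: "H \<in> W"
            let ?S = "{v \<in> M k. v \<inter> H \<noteq> {}}"
            have oH: "openin X H" using H W(1) by (auto simp: disjoint_open_family_def)
            have dis: "disjnt u v" if "u \<in> M k" "v \<in> M k" "u \<noteq> v" for u v
              using M[of k] that by (auto simp: disjoint_open_family_def pairwise_def)
            have inj: "inj_on (\<lambda>v. v \<inter> H) ?S"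
            proof (rule inj_onI, rule ccontr)
              fix u v assume "u \<in> ?S" "v \<in> ?S" "u \<inter> H = v \<inter> H" "u \<noteq> v"
              with dis[of u v] show False by (auto simp: disjnt_iff)
            qed
            have fam: "disjoint_open_family X ((\<lambda>v. v \<inter> H) ` ?S)"
              using M[of k] oH dis unfolding disjoint_open_family_def pairwise_def disjnt_iff
              by (auto intro: openin_Int)
            have "\<not> |M N| \<le>o |?S|"
            proof
              assume "|M N| \<le>o |?S|"
              then have "|M N| \<le>o |(\<lambda>v. v \<inter> H) ` ?S|"
                using inj card_of_ordIsoI[OF inj_on_imp_bij_betw] ordLeq_ordIso_trans by blast
              then have "large N H" using fam unfolding large_def by blast
              then show False using N H by blast
            qed
            then have "|?S| \<le>o |M N|" using ordLeq_total card_of_Well_order by blast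
            then show "|?S| \<le>o |?B|" using mono[of N "max m N"] ordLeq_transitive by auto
          qed
          ultimately show ?thesis using card_of_mono1 ordLeq_transitive by blast
        qed
        then show False using none M by blast
      qed
    qed
  qed
  then obtain V where V: "disjoint_open_family X V" "\<And>n. |M n| \<le>o |V|" by blast
  then have inf: "infinite V" using M card_of_ordLeq_infinite by blast
  have "|U n| \<le>o |V|" for n using M_Suc V(2) ordLeq_transitive by blast
  then have "|\<Union>n. U n| \<le>o |V|"
    using inf by (intro card_of_UNION_ordLeq_infinite) (auto simp: infinite_iff_card_of_nat)
  with V inf show ?thesis by blast
qed

subsection \<open>Oscillation of separately continuous maps\<close>

lemma mdist_self: "x \<in> mspace m \<Longrightarrow> mdist m x x = 0"
  by simp

lemma openin_mdist_less:
  assumes "continuous_map X (mtopology_of m) f" "continuous_map X (mtopology_of m) h"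
  shows "openin X {x \<in> topspace X. mdist m (f x) (h x) < r}"
  using openin_continuous_map_preimage[OF continuous_map_mdist[OF assms], of "{..<r}"] by simp

lemma openin_mdist_greater:
  assumes "continuous_map X (mtopology_of m) f" "continuous_map X (mtopology_of m) h"
  shows "openin X {x \<in> topspace X. r < mdist m (f x) (h x)}"
  using openin_continuous_map_preimage[OF continuous_map_mdist[OF assms], of "{r<..}"] by simp

lemma closedin_mdist_le:
  assumes "continuous_map X (mtopology_of m) f" "continuous_map X (mtopology_of m) h"
  shows "closedin X {x \<in> topspace X. mdist m (f x) (h x) \<le> r}"
  using closedin_continuous_map_preimage[OF continuous_map_mdist[OF assms], of "{..r}"] by simp

lemma closedin_mdist_ge:
  assumes "continuous_map X (mtopology_of m) f" "continuous_map X (mtopology_of m) h"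
  shows "closedin X {x \<in> topspace X. r \<le> mdist m (f x) (h x)}"
  using closedin_continuous_map_preimage[OF continuous_map_mdist[OF assms], of "{r..}"] by simp

lemma openin_finite_Ball:
  assumes "finite A" "\<And>a. a \<in> A \<Longrightarrow> openin X {x \<in> topspace X. P a x}"
  shows "openin X {x \<in> topspace X. \<forall>a\<in>A. P a x}"
  using assms
proof (induction A)
  case (insert a A)
  have "{x \<in> topspace X. \<forall>b\<in>insert a A. P b x}
      = {x \<in> topspace X. P a x} \<inter> {x \<in> topspace X. \<forall>b\<in>A. P b x}" by auto
  then show ?case using insert by auto
qed simp

lemma compact_space_finite_cover:
  assumes "compact_space X" "\<And>x. x \<in> topspace X \<Longrightarrow> openin X (N x) \<and> x \<in> N x"
  obtains F where "finite F" "F \<subseteq> topspace X" "topspace X \<subseteq> (\<Union>x\<in>F. N x)"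
proof -
  have "\<exists>\<F>. finite \<F> \<and> \<F> \<subseteq> N ` topspace X \<and> topspace X \<subseteq> \<Union>\<F>"
    using assms(1) unfolding compact_space_def compactin_def
    by (elim conjE allE[of _ "N ` topspace X"]) (use assms(2) in blast)
  then show ?thesis using that by (metis finite_subset_image)
qed

text \<open>Compactness of \<open>Y\<close> lets one finite set serve all maps indexed by the finite
  \<open>A\<close> simultaneously. For a singleton \<open>A\<close> this is total boundedness of the
  image, with the net pulled back to \<open>Y\<close>.\<close>

lemma finite_net:
  assumes "compact_space Y" "finite A" "\<And>a. a \<in> A \<Longrightarrow> continuous_map Y (mtopology_of m) (f a)" "0 < r"
  obtains F where "finite F" "F \<subseteq> topspace Y"
    "\<And>y. y \<in> topspace Y \<Longrightarrow> \<exists>z\<in>F. \<forall>a\<in>A. mdist m (f a y) (f a z) < r"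
proof -
  let ?N = "\<lambda>z. {y \<in> topspace Y. \<forall>a\<in>A. mdist m (f a y) (f a z) < r}"
  have in_m: "f a y \<in> mspace m" if "a \<in> A" "y \<in> topspace Y" for a y
    using continuous_map_funspace[OF assms(3)[OF that(1)]] that(2) by auto
  have "openin Y (?N z) \<and> z \<in> ?N z" if "z \<in> topspace Y" for z
    using that assms in_m by (auto intro!: openin_finite_Ball openin_mdist_less simp: mdist_self)
  then obtain F where "finite F" "F \<subseteq> topspace Y" "topspace Y \<subseteq> (\<Union>z\<in>F. ?N z)"
    by (rule compact_space_finite_cover[OF assms(1)])
  then show ?thesis using that[of F] by blast
qed

section \<open>Namioka's theorem in oscillation form\<close>

text \<open>If the oscillation never drops below \<open>e\<close>, finite sets \<open>A n\<close>
  grow and open sets \<open>H n\<close> shrink while pairs \<open>(y n, y' n)\<close> are found that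
  \<open>g a\<close> hardly distinguishes for \<open>a\<close> in \<open>A n\<close>, yet
  \<open>g x\<close> keeps \<open>e / 4\<close> apart for \<open>x\<close> in
  \<open>H (Suc n)\<close>. Compactness turns this into a contradiction in the limit.\<close>

lemma Namioka_oscillation:
  fixes g :: "'a \<Rightarrow> 'b \<Rightarrow> 'm" and m :: "'m metric"
  assumes X: "compact_space X" "Hausdorff_space X" and Y: "compact_space Y"
    and gY: "\<And>x. x \<in> topspace X \<Longrightarrow> continuous_map Y (mtopology_of m) (g x)"
    and gX: "\<And>y. y \<in> topspace Y \<Longrightarrow> continuous_map X (mtopology_of m) (\<lambda>x. g x y)"
    and G: "openin X G" "G \<noteq> {}" and "0 < e"
  shows "\<exists>H\<subseteq>G. openin X H \<and> H \<noteq> {} \<and>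
    (\<forall>x\<in>H. \<forall>x'\<in>H. \<forall>y\<in>topspace Y. mdist m (g x y) (g x' y) < e)"
proof (rule ccontr)
  assume "\<not> ?thesis"
  then have osc: "\<exists>x\<in>H. \<exists>x'\<in>H. \<exists>y\<in>topspace Y. e \<le> mdist m (g x y) (g x' y)"
    if "openin X H" "H \<noteq> {}" "H \<subseteq> G" for H
    using that by (meson not_le)
  have in_m: "g x y \<in> mspace m" if "x \<in> topspace X" "y \<in> topspace Y" for x y
    using continuous_map_funspace[OF gY[OF that(1)]] that(2) by auto
  \<comment> \<open>Otherwise points of \<open>Y\<close> that are close for the finitely many \<open>g a\<close> would be close for all \<open>g x\<close>, \<open>x \<in> H\<close>, and
    comparing values on a finite net of \<open>Y\<close> would bound the oscillation of \<open>g\<close> near any point of \<open>H\<close>.\<close>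
  have separate: "\<exists>x\<in>H. \<exists>y\<in>topspace Y. \<exists>y'\<in>topspace Y.
      (\<forall>a\<in>A. mdist m (g a y) (g a y') < r) \<and> e / 4 < mdist m (g x y) (g x y')"
    if A: "finite A" "A \<subseteq> topspace X" and H: "openin X H" "H \<noteq> {}" "H \<subseteq> G" and "0 < r" for A H r
  proof (rule ccontr)
    assume "\<not> ?thesis"
    then have equi: "mdist m (g x y) (g x y') \<le> e / 4" if "x \<in> H" "y \<in> topspace Y" "y' \<in> topspace Y"
      "\<forall>a\<in>A. mdist m (g a y) (g a y') < r" for x y y'
      using that by (meson not_le)
    have HX: "H \<subseteq> topspace X" using H(1) openin_subset by blast
    obtain F where F: "finite F" "F \<subseteq> topspace Y"
      "\<And>y. y \<in> topspace Y \<Longrightarrow> \<exists>z\<in>F. \<forall>a\<in>A. mdist m (g a y) (g a z) < r"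
      using finite_net[OF Y A(1) _ \<open>0 < r\<close>, of m g] gY A(2) by blast
    obtain x0 where x0: "x0 \<in> H" using H by blast
    \<comment> \<open>With \<open>e / 8\<close> the values at a net point \<open>z\<close> vary by
      less than \<open>e / 4\<close> over \<open>?N\<close>. Two applications of \<open>equi\<close>
      add \<open>e / 2\<close>, so the total is below \<open>3 * e / 4\<close>, against the
      oscillation \<open>e\<close>.\<close>
    let ?N = "{x \<in> topspace X. \<forall>z\<in>F. mdist m (g x z) (g x0 z) < e / 8}"
    have "openin X ?N"
    proof (intro openin_finite_Ball openin_mdist_less F(1))
      fix z assume "z \<in> F"
      then show "continuous_map X (mtopology_of m) (\<lambda>x. g x z)"
        "continuous_map X (mtopology_of m) (\<lambda>x. g x0 z)"
        using F(2) gX in_m[of x0 z] x0 HX by auto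
    qed
    moreover have "x0 \<in> ?N"
      using x0 HX F(2) \<open>0 < e\<close> in_m by (auto simp: mdist_self subset_iff)
    ultimately obtain x x' y where x: "x \<in> H \<inter> ?N" and x': "x' \<in> H \<inter> ?N" and y: "y \<in> topspace Y"
        and far: "e \<le> mdist m (g x y) (g x' y)"
      using osc[of "H \<inter> ?N"] H x0 by blast
    obtain z where z: "z \<in> F" "\<forall>a\<in>A. mdist m (g a y) (g a z) < r" using F(3)[OF y] by blast
    have zY: "z \<in> topspace Y" using z F by blast
    have M: "g x y \<in> mspace m" "g x' y \<in> mspace m" "g x z \<in> mspace m" "g x' z \<in> mspace m"
        "g x0 z \<in> mspace m"
      using x x' x0 HX y zY in_m by blast+
    have "mdist m (g x y) (g x z) \<le> e / 4" "mdist m (g x' y) (g x' z) \<le> e / 4"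
      using equi[OF _ y zY z(2)] x x' by blast+
    moreover have "mdist m (g x z) (g x0 z) < e / 8" "mdist m (g x' z) (g x0 z) < e / 8"
      using x x' z by blast+
    moreover have "mdist m (g x y) (g x' y) \<le> mdist m (g x y) (g x z) + mdist m (g x z) (g x' y)"
      "mdist m (g x z) (g x' y) \<le> mdist m (g x z) (g x' z) + mdist m (g x' z) (g x' y)"
      "mdist m (g x z) (g x' z) \<le> mdist m (g x z) (g x0 z) + mdist m (g x0 z) (g x' z)"
      using M by (intro mdist_triangle; blast)+
    moreover have "mdist m (g x' z) (g x' y) = mdist m (g x' y) (g x' z)"
      "mdist m (g x0 z) (g x' z) = mdist m (g x' z) (g x0 z)"
      by (rule mdist_commute)+
    ultimately show False using far \<open>0 < e\<close> by linarith
  qed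
  \<comment> \<open>A state carries a finite set, an open set and a pair of points. The pair is
    unconstrained here, so the initial state may use \<open>undefined\<close>. That \<open>A\<close>
    meets \<open>H\<close> supplies the points whose cluster point is taken later.\<close>
  define P where "P \<equiv> \<lambda>(A, H, y :: 'b, y' :: 'b). finite A \<and> A \<subseteq> topspace X \<and>
      openin X H \<and> H \<noteq> {} \<and> H \<subseteq> G \<and> A \<inter> H \<noteq> {}"
  \<comment> \<open>The second pattern rebinds \<open>y\<close> and \<open>y'\<close>, so all
    conditions concern the new pair. The lower bound is non-strict and imposed on the closure of
    \<open>H'\<close>, because the cluster point in \<open>X\<close> is only known to lie in
    closures.\<close>
  define Q where "Q \<equiv> \<lambda>n (A, H, y :: 'b, y' :: 'b) (A', H', y, y').
      A \<subseteq> A' \<and> H' \<subseteq> H \<and> y \<in> topspace Y \<and> y' \<in> topspace Y \<and>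
      (\<forall>a\<in>A. mdist m (g a y) (g a y') < inverse (real (Suc n))) \<and>
      (\<forall>x\<in>X closure_of H'. e / 4 \<le> mdist m (g x y) (g x y'))"
  have "\<exists>q. P q \<and> Q n p q" if "P p" for p n
  proof -
    obtain A H u v where p: "p = (A, H, u, v)" by (cases p) auto
    have AH: "finite A" "A \<subseteq> topspace X" "openin X H" "H \<noteq> {}" "H \<subseteq> G"
      using that by (auto simp: p P_def)
    obtain x y y' where x: "x \<in> H" and y: "y \<in> topspace Y" "y' \<in> topspace Y"
      "\<forall>a\<in>A. mdist m (g a y) (g a y') < inverse (real (Suc n))"
      and far: "e / 4 < mdist m (g x y) (g x y')"
      using separate[OF AH, of "inverse (real (Suc n))"] by auto
    have xX: "x \<in> topspace X" using x AH(3) openin_subset by blast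
    let ?N = "{x \<in> topspace X. e / 4 < mdist m (g x y) (g x y')}"
    let ?C = "{x \<in> topspace X. e / 4 \<le> mdist m (g x y) (g x y')}"
    have "openin X ?N" "closedin X ?C"
      using gX y by (intro openin_mdist_greater closedin_mdist_ge; blast)+
    then have "X closure_of (H \<inter> ?N) \<subseteq> ?C"
      by (intro closure_of_minimal) auto
    then have "P (insert x A, H \<inter> ?N, y, y') \<and> Q n p (insert x A, H \<inter> ?N, y, y')"
      using AH x xX far y \<open>openin X ?N\<close> by (auto simp: P_def Q_def p)
    then show ?thesis by blast
  qed
  moreover obtain x0 where x0: "x0 \<in> G" using G by blast
  then have "P ({x0}, G, undefined, undefined)"
    using G openin_subset by (auto simp: P_def)
  ultimately obtain f where f: "\<And>n. P (f n)" "\<And>n. Q n (f n) (f (Suc n))"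
    using dependent_nat_choice[of "\<lambda>_. P" Q] by metis
  define A where "A n = fst (f n)" for n
  define H where "H n = fst (snd (f n))" for n
  \<comment> \<open>The pair is read from stage \<open>Suc n\<close>: it is the one chosen with
    respect to \<open>A n\<close>, and the arbitrary pair of stage \<open>0\<close> is
    skipped.\<close>
  define y where "y n = fst (snd (snd (f (Suc n))))" for n
  define y' where "y' n = snd (snd (snd (f (Suc n))))" for n
  have AH: "finite (A n)" "A n \<subseteq> topspace X" "A n \<inter> H n \<noteq> {}" for n
    using f(1)[of n] by (auto simp: P_def A_def H_def split: prod.splits)
  have f_eq: "f n = (A n, H n, fst (snd (snd (f n))), snd (snd (snd (f n))))" for n
    by (simp add: A_def H_def)
  have step: "A n \<subseteq> A (Suc n)" "H (Suc n) \<subseteq> H n" "y n \<in> topspace Y" "y' n \<in> topspace Y"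
    "\<And>a. a \<in> A n \<Longrightarrow> mdist m (g a (y n)) (g a (y' n)) < inverse (real (Suc n))"
    "\<And>x. x \<in> X closure_of (H (Suc n)) \<Longrightarrow> e / 4 \<le> mdist m (g x (y n)) (g x (y' n))" for n
    using f(2)[of n] by (auto simp: Q_def A_def H_def y_def y'_def split: prod.splits)
  have A_mono: "A i \<subseteq> A j" if "i \<le> j" for i j
    using lift_Suc_mono_le[of A] step(1) that by blast
  have H_anti: "H j \<subseteq> H i" if "i \<le> j" for i j
    using lift_Suc_antimono_le[of H] step(2) that by blast
  \<comment> \<open>A cluster point \<open>xs\<close> of the points in the \<open>A n\<close> and a cluster point \<open>(ys, ys')\<close> of the pairs \<open>(y n, y' n)\<close>
    contradict each other: \<open>g a ys = g a ys'\<close> for all \<open>a\<close>, hence also for \<open>xs\<close>.\<close>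
  define C where "C n = X closure_of ((\<Union>k. A k) \<inter> H n)" for n
  have "(\<Inter>n. C n) \<noteq> {}"
  proof (rule compact_space_imp_nest[OF X(1)])
    show "closedin X (C n)" for n by (simp add: C_def)
    show "C n \<noteq> {}" for n
    proof -
      obtain a where "a \<in> A n \<inter> H n" using AH(3) by blast
      then have "a \<in> C n"
        unfolding C_def using AH(2)[of n]
        by (intro closure_of_subset_Int[THEN subsetD]) auto
      then show ?thesis by blast
    qed
    show "decseq C"
      unfolding C_def decseq_def using H_anti by (blast intro: closure_of_mono[THEN subsetD])
  qed
  then obtain xs where xs: "\<And>n. xs \<in> C n" by blast
  define D where "D n = (prod_topology Y Y) closure_of ((\<lambda>k. (y k, y' k)) ` {n..})" for n
  have "(\<Inter>n. D n) \<noteq> {}"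
  proof (rule compact_space_imp_nest[of "prod_topology Y Y"])
    show "compact_space (prod_topology Y Y)" using Y by (simp add: compact_space_prod_topology)
    show "closedin (prod_topology Y Y) (D n)" for n by (simp add: D_def)
    show "D n \<noteq> {}" for n
    proof -
      have "(y n, y' n) \<in> D n"
        unfolding D_def using step(3,4)
        by (intro closure_of_subset[THEN subsetD]) auto
      then show ?thesis by blast
    qed
    show "decseq D"
      unfolding D_def decseq_def by (intro allI impI closure_of_mono) auto
  qed
  then obtain ys ys' where ys: "\<And>n. (ys, ys') \<in> D n" by (metis INT_E UNIV_I ex_in_conv surj_pair)
  have ysY: "ys \<in> topspace Y" "ys' \<in> topspace Y"
    using ys[of 0] closure_of_subset_topspace[of "prod_topology Y Y"] by (auto simp: D_def)
  have xsX: "xs \<in> topspace X"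
    using xs[of 0] closure_of_subset_topspace[of X] by (auto simp: C_def)
  have gfst: "continuous_map (prod_topology Y Y) (mtopology_of m) (\<lambda>p. g x (fst p))"
    and gsnd: "continuous_map (prod_topology Y Y) (mtopology_of m) (\<lambda>p. g x (snd p))"
    if "x \<in> topspace X" for x
    using continuous_map_compose[OF continuous_map_fst gY[OF that]]
      continuous_map_compose[OF continuous_map_snd gY[OF that]] by (simp_all add: o_def)
  have zero: "mdist m (g a ys) (g a ys') \<le> 0" if a: "a \<in> (\<Union>k. A k)" for a
  proof (rule ccontr)
    assume "\<not> ?thesis"
    then obtain n where n: "inverse (real (Suc n)) < mdist m (g a ys) (g a ys')"
      by (meson not_le reals_Archimedean)
    obtain j where j: "a \<in> A j" using a by blast
    \<comment> \<open>From stage \<open>j\<close> on, \<open>a\<close> belongs to the finite sets,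
      and from stage \<open>n\<close> on the distances are below
      \<open>inverse (real (Suc n))\<close>. The tail from \<open>?k\<close> satisfies both, and the
      resulting closed condition passes to \<open>(ys, ys')\<close>.\<close>
    let ?k = "max n j"
    have aX: "a \<in> topspace X" using j AH(2) by blast
    have "D ?k \<subseteq> {p \<in> topspace (prod_topology Y Y). mdist m (g a (fst p)) (g a (snd p)) \<le> inverse (real (Suc n))}"
      unfolding D_def
    proof (intro closure_of_minimal closedin_mdist_le gfst gsnd aX subsetI)
      fix p assume "p \<in> (\<lambda>k. (y k, y' k)) ` {?k..}"
      then obtain k where k: "n \<le> k" "j \<le> k" and p: "p = (y k, y' k)" by auto
      have "mdist m (g a (y k)) (g a (y' k)) < inverse (real (Suc k))"
        using step(5) A_mono[OF k(2)] j by blast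
      also have "\<dots> \<le> inverse (real (Suc n))" using k(1) by simp
      finally show "p \<in> {p \<in> topspace (prod_topology Y Y). mdist m (g a (fst p)) (g a (snd p)) \<le> inverse (real (Suc n))}"
        using step(3,4) by (auto simp: p)
    qed
    with ys[of ?k] n show False by auto
  qed
  have "D 0 \<subseteq> {p \<in> topspace (prod_topology Y Y). e / 4 \<le> mdist m (g xs (fst p)) (g xs (snd p))}"
    unfolding D_def
  proof (intro closure_of_minimal closedin_mdist_ge gfst gsnd xsX subsetI)
    fix p assume "p \<in> (\<lambda>k. (y k, y' k)) ` {0..}"
    then obtain k where p: "p = (y k, y' k)" by auto
    have "xs \<in> X closure_of (H (Suc k))"
      using xs[of "Suc k"] unfolding C_def by (blast intro: closure_of_mono[THEN subsetD])
    then show "p \<in> {p \<in> topspace (prod_topology Y Y). e / 4 \<le> mdist m (g xs (fst p)) (g xs (snd p))}"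
      using step(3,4,6) by (auto simp: p)
  qed
  then have "e / 4 \<le> mdist m (g xs ys) (g xs ys')" using ys[of 0] by auto
  moreover have "X closure_of (\<Union>k. A k) \<subseteq> {x \<in> topspace X. mdist m (g x ys) (g x ys') \<le> 0}"
    using zero AH(2) by (intro closure_of_minimal closedin_mdist_le gX ysY) auto
  then have "mdist m (g xs ys) (g xs ys') \<le> 0"
    using xs[of 0] unfolding C_def by (blast dest: closure_of_mono[THEN subsetD, rotated])
  ultimately show False using \<open>0 < e\<close> by linarith
qed

subsection \<open>Density and weight\<close>

lemma card_of_finite_ordLeq_infinite:
  assumes "finite A" "infinite B"
  shows "|A| \<le>o |B|"
  using assms card_of_ordLeq_finite[of B A]
    ordLeq_total[OF card_of_Well_order[of A] card_of_Well_order[of B]] by blast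

text \<open>A finite \<open>F\<close> arises from the empty set by \<open>card F\<close> insertions.
  Each round of insertions is an image of \<open>S \<times> E n\<close> and so stays within the
  infinite \<open>|B|\<close>, as does the countable union of all rounds. Comparing with
  \<open>B\<close> rather than \<open>S\<close> also covers finite \<open>S\<close>.\<close>

lemma card_of_finite_subsets_ordLeq:
  assumes "infinite B" "|S| \<le>o |B|"
  shows "|{F. finite F \<and> F \<subseteq> S}| \<le>o |B|"
proof -
  define E where "E = rec_nat {{}} (\<lambda>_ \<F>. (\<lambda>(x, F). insert x F) ` (S \<times> \<F>))"
  have E: "E 0 = {{}}" "E (Suc n) = (\<lambda>(x, F). insert x F) ` (S \<times> E n)" for n
    by (simp_all add: E_def)
  have "|E n| \<le>o |B|" for n
  proof (induction n)
    case 0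
    then show ?case using assms by (simp add: E card_of_finite_ordLeq_infinite)
  next
    case (Suc n)
    have "|S \<times> E n| \<le>o |B|"
      using assms Suc by (intro card_of_Sigma_ordLeq_infinite) auto
    then show ?case unfolding E by (rule ordLeq_transitive[OF card_of_image])
  qed
  then have "|\<Union>n. E n| \<le>o |B|"
    using assms by (intro card_of_UNION_ordLeq_infinite) (auto simp: infinite_iff_card_of_nat)
  moreover have "F \<in> E (card F)" if "finite F" "F \<subseteq> S" for F
    using that
  proof (induction F)
    case (insert x F)
    then show ?case by (force simp: E)
  qed (simp add: E)
  then have "{F. finite F \<and> F \<subseteq> S} \<subseteq> (\<Union>n. E n)" by blast
  ultimately show ?thesis by (meson card_of_mono1 ordLeq_transitive)
qed

text \<open>Density of the range is expressed through index pairs \<open>D\<close>, so that the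
  dense values remain point evaluations later on. The family \<open>V\<close> is kept as a witness,
  because the cardinality of \<open>D\<close> has to be bounded by that of one disjoint open family
  of \<open>X\<close>.\<close>

lemma dense_subset_below_sharp_cellularity:
  fixes g :: "'a \<Rightarrow> 'b \<Rightarrow> 'm" and m :: "'m metric"
  assumes X: "compact_space X" "Hausdorff_space X" "infinite (topspace X)" and Y: "compact_space Y"
    and gY: "\<And>x. x \<in> topspace X \<Longrightarrow> continuous_map Y (mtopology_of m) (g x)"
    and gX: "\<And>y. y \<in> topspace Y \<Longrightarrow> continuous_map X (mtopology_of m) (\<lambda>x. g x y)"
  shows "\<exists>D V. D \<subseteq> topspace X \<times> topspace Y \<and> disjoint_open_family X V \<and> infinite V \<and> |D| \<le>o |V| \<and>
    (\<forall>x\<in>topspace X. \<forall>y\<in>topspace Y. \<forall>e>0. \<exists>(a, b)\<in>D. mdist m (g x y) (g a b) < e)"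
proof -
  define small where "small n H \<longleftrightarrow> (\<forall>x\<in>H. \<forall>x'\<in>H. \<forall>y\<in>topspace Y.
      mdist m (g x y) (g x' y) < inverse (real (Suc n)))" for n H
  have "\<exists>W. disjoint_open_family X W \<and> (\<forall>H\<in>W. small n H) \<and>
      (\<forall>G. openin X G \<longrightarrow> G \<noteq> {} \<longrightarrow> (\<exists>H\<in>W. G \<inter> H \<noteq> {}))" for n
  proof -
    have osc: "\<exists>H\<subseteq>G. openin X H \<and> H \<noteq> {} \<and> small n H" if "openin X G" "G \<noteq> {}" for G
      unfolding small_def by (rule Namioka_oscillation[OF X(1,2) Y gY gX that]) auto
    show ?thesis
      by (rule maximal_disjoint_open_family[of X "small n", OF osc])
  qed
  then obtain W where W: "\<And>n. disjoint_open_family X (W n)" "\<And>n H. H \<in> W n \<Longrightarrow> small n H"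
      "\<And>n G. openin X G \<Longrightarrow> G \<noteq> {} \<Longrightarrow> \<exists>H\<in>W n. G \<inter> H \<noteq> {}"
    by metis
  define pt :: "'a set \<Rightarrow> 'a" where "pt H = (SOME x. x \<in> H)" for H
  have pt: "pt H \<in> H" "pt H \<in> topspace X" if "H \<in> W n" for n H
  proof -
    have "openin X H" "H \<noteq> {}" using that W(1)[of n] by (auto simp: disjoint_open_family_def)
    then have "pt H \<in> H" "H \<subseteq> topspace X"
      unfolding pt_def by (simp_all add: some_in_eq openin_subset)
    then show "pt H \<in> H" "pt H \<in> topspace X" by auto
  qed
  have "\<exists>F. finite F \<and> F \<subseteq> topspace Y \<and>
      (\<forall>y\<in>topspace Y. \<exists>z\<in>F. mdist m (g x y) (g x z) < inverse (real (Suc n)))"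
    if "x \<in> topspace X" for x n
    by (rule finite_net[OF Y, of "{x}" m g "inverse (real (Suc n))"]) (use gY that in auto)
  then obtain F where F: "\<And>x n. x \<in> topspace X \<Longrightarrow> finite (F x n)"
    "\<And>x n. x \<in> topspace X \<Longrightarrow> F x n \<subseteq> topspace Y"
    "\<And>x n y. x \<in> topspace X \<Longrightarrow> y \<in> topspace Y \<Longrightarrow>
      \<exists>z\<in>F x n. mdist m (g x y) (g x z) < inverse (real (Suc n))"
    by metis
  obtain V where V: "disjoint_open_family X V" "infinite V" "|\<Union>n. W n| \<le>o |V|"
    using exists_infinite_disjoint_open_family[OF X(2,3)] Erdos_Tarski_countable[of X _ W] W(1) by metis
  define D where "D = (\<Union>n. \<Union>H\<in>W n. Pair (pt H) ` F (pt H) n)"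
  have "|W n| \<le>o |V|" for n
    using V(3) card_of_mono1[of "W n" "\<Union>n. W n"] ordLeq_transitive by blast
  then have "|\<Union>H\<in>W n. Pair (pt H) ` F (pt H) n| \<le>o |V|" for n
    by (rule card_of_UNION_ordLeq_infinite[OF V(2)])
      (use V(2) pt(2) F(1) in \<open>auto intro!: card_of_finite_ordLeq_infinite\<close>)
  then have "|D| \<le>o |V|"
    unfolding D_def using V(2)
    by (intro card_of_UNION_ordLeq_infinite) (auto simp: infinite_iff_card_of_nat[symmetric])
  moreover have "D \<subseteq> topspace X \<times> topspace Y"
    using pt(2) F(2) by (fastforce simp: D_def)
  moreover have "\<exists>(a, b)\<in>D. mdist m (g x y) (g a b) < e"
    if x: "x \<in> topspace X" and y: "y \<in> topspace Y" and "0 < e" for x y e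
  proof -
    \<comment> \<open>Three approximations are added: from \<open>x\<close> to a nearby
      \<open>x'\<close> in some member \<open>H\<close> of the dense family, from \<open>x'\<close>
      to the chosen point of \<open>H\<close> by small oscillation, and from \<open>y\<close> to the
      net of that point.\<close>
    obtain n where n: "inverse (real (Suc n)) < e / 3"
      using reals_Archimedean[of "e / 3"] \<open>0 < e\<close> by auto
    have in_m: "g x y \<in> mspace m" if "x \<in> topspace X" "y \<in> topspace Y" for x y
      using continuous_map_funspace[OF gY[OF that(1)]] that(2) by auto
    let ?G = "{x' \<in> topspace X. mdist m (g x' y) (g x y) < inverse (real (Suc n))}"
    have "openin X ?G" using gX y in_m[OF x y] by (intro openin_mdist_less) auto
    moreover have "x \<in> ?G" using x in_m[OF x y] by (simp add: mdist_self)
    ultimately obtain H x' where H: "H \<in> W n" and x': "x' \<in> ?G" "x' \<in> H" using W(3)[of ?G n] by blast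
    let ?a = "pt H"
    obtain b where b: "b \<in> F ?a n" "mdist m (g ?a y) (g ?a b) < inverse (real (Suc n))"
      using F(3)[OF pt(2)[OF H] y] by blast
    have bY: "b \<in> topspace Y" using b(1) F(2) pt(2)[OF H] by blast
    have M: "g x y \<in> mspace m" "g x' y \<in> mspace m" "g ?a y \<in> mspace m" "g ?a b \<in> mspace m"
      using in_m x y x' pt(2)[OF H] bY by blast+
    have "mdist m (g x' y) (g ?a y) < inverse (real (Suc n))"
      using W(2)[OF H] x'(2) pt(1)[OF H] y unfolding small_def by blast
    moreover have "mdist m (g x y) (g ?a b) \<le> mdist m (g x y) (g x' y) + mdist m (g x' y) (g ?a b)"
      "mdist m (g x' y) (g ?a b) \<le> mdist m (g x' y) (g ?a y) + mdist m (g ?a y) (g ?a b)"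
      using M by (intro mdist_triangle; blast)+
    moreover have "mdist m (g x y) (g x' y) < inverse (real (Suc n))"
      using x'(1) mdist_commute by (metis (mono_tags, lifting) mem_Collect_eq)
    ultimately have "mdist m (g x y) (g ?a b) < e" using b(2) n by linarith
    moreover have "(?a, b) \<in> D" unfolding D_def using H b(1) by blast
    ultimately show ?thesis by blast
  qed
  ultimately show ?thesis using V(1,2) by blast
qed

section \<open>Bases of compact spaces from separating maps\<close>

text \<open>Preimages of small balls around the values at finite nets form a family \<open>S\<close>
  of at most \<open>|B|\<close> open sets that separates points by disjoint neighbourhoods. By
  compactness the finite intersections of members of \<open>S\<close> form a base.\<close>

lemma base_from_separating_family:
  fixes e :: "'q \<Rightarrow> 'k \<Rightarrow> 'm"
  assumes T: "compact_space T"
    and e: "\<And>q. q \<in> D \<Longrightarrow> continuous_map T (mtopology_of m) (e q)"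
    and sep: "\<And>s t. s \<in> topspace T \<Longrightarrow> t \<in> topspace T \<Longrightarrow> s \<noteq> t \<Longrightarrow> \<exists>q\<in>D. e q s \<noteq> e q t"
    and B: "infinite B" "|D| \<le>o |B|"
  shows "\<exists>\<B>. is_base T \<B> \<and> |\<B>| \<le>o |B|"
proof -
  have "\<exists>F. finite F \<and> F \<subseteq> topspace T \<and>
      (\<forall>t\<in>topspace T. \<exists>z\<in>F. mdist m (e q t) (e q z) < inverse (real (Suc n)))" if "q \<in> D" for q n
    by (rule finite_net[OF T, of "{q}" m e "inverse (real (Suc n))"]) (use e that in auto)
  then obtain F where F: "\<And>q n. q \<in> D \<Longrightarrow> finite (F q n)" "\<And>q n. q \<in> D \<Longrightarrow> F q n \<subseteq> topspace T"
    "\<And>q n t. q \<in> D \<Longrightarrow> t \<in> topspace T \<Longrightarrow> \<exists>z\<in>F q n. mdist m (e q t) (e q z) < inverse (real (Suc n))"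
    by metis
  have in_m: "e q t \<in> mspace m" if "q \<in> D" "t \<in> topspace T" for q t
    using continuous_map_funspace[OF e[OF that(1)]] that(2) by auto
  define N where "N q n z = {t \<in> topspace T. mdist m (e q t) (e q z) < inverse (real (Suc n))}" for q n z
  define S where "S = (\<Union>q\<in>D. \<Union>n. N q n ` F q n)"
  have openS: "openin T u" if u: "u \<in> S" for u
  proof -
    obtain q n z where qz: "q \<in> D" "z \<in> F q n" "u = N q n z" using u unfolding S_def by blast
    then have "e q z \<in> mspace m" using F(2) in_m by blast
    then show ?thesis unfolding qz(3) N_def using e qz(1) by (intro openin_mdist_less) auto
  qed
  have "|\<Union>n. N q n ` F q n| \<le>o |B|" if "q \<in> D" for q
    by (rule card_of_UNION_ordLeq_infinite)
      (use B F(1)[OF that] in \<open>auto simp: infinite_iff_card_of_nat[symmetric] intro: card_of_finite_ordLeq_infinite\<close>)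
  then have "|S| \<le>o |B|"
    unfolding S_def using B by (intro card_of_UNION_ordLeq_infinite) auto
  \<comment> \<open>Intersecting within the space makes \<open>cap {}\<close> the whole space
    instead of \<open>UNIV\<close>.\<close>
  define cap where "cap F = {t \<in> topspace T. \<forall>u\<in>F. t \<in> u}" for F
  define \<B> where "\<B> = cap ` {F. finite F \<and> F \<subseteq> S}"
  have card: "|\<B>| \<le>o |B|"
    unfolding \<B>_def
    by (rule ordLeq_transitive[OF card_of_image card_of_finite_subsets_ordLeq[OF B(1) \<open>|S| \<le>o |B|\<close>]])
  have open\<B>: "openin T b" if "b \<in> \<B>" for b
  proof -
    obtain F where F: "finite F" "F \<subseteq> S" "b = cap F" using \<open>b \<in> \<B>\<close> by (auto simp: \<B>_def)
    have "openin T {t \<in> topspace T. t \<in> u}" if "u \<in> F" for u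
    proof -
      have "openin T u" using openS that F by blast
      moreover have "{t \<in> topspace T. t \<in> u} = u" using openin_subset[OF calculation] by blast
      ultimately show ?thesis by simp
    qed
    then show ?thesis unfolding F cap_def using F(1) by (intro openin_finite_Ball)
  qed
  have separate: "\<exists>a\<in>S. \<exists>b\<in>S. s \<in> a \<and> t \<in> b \<and> disjnt a b"
    if st: "s \<in> topspace T" "t \<in> topspace T" "s \<noteq> t" for s t
  proof -
    obtain q where q: "q \<in> D" "e q s \<noteq> e q t" using sep[OF st] by blast
    let ?d = "mdist m (e q s) (e q t)"
    have "?d \<noteq> 0" using q in_m st by simp
    \<comment> \<open>A common point \<open>p\<close> of the two neighbourhoods would link
      \<open>e q s\<close> to \<open>e q t\<close> by four distances, each below
      \<open>?d / 4\<close>.\<close>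
    then have "0 < ?d / 4" using mdist_nonneg[of m "e q s" "e q t"] by linarith
    then obtain n where n: "inverse (real (Suc n)) < ?d / 4" using reals_Archimedean by blast
    obtain z z' where z: "z \<in> F q n" "mdist m (e q s) (e q z) < inverse (real (Suc n))"
      and z': "z' \<in> F q n" "mdist m (e q t) (e q z') < inverse (real (Suc n))"
      using F(3)[OF q(1) st(1)] F(3)[OF q(1) st(2)] by metis
    have "False" if p: "p \<in> topspace T" "mdist m (e q p) (e q z) < inverse (real (Suc n))"
      "mdist m (e q p) (e q z') < inverse (real (Suc n))" for p
    proof -
      have M: "e q s \<in> mspace m" "e q t \<in> mspace m" "e q z \<in> mspace m" "e q z' \<in> mspace m" "e q p \<in> mspace m"
        using in_m q st p z(1) z'(1) F(2) by blast+
      have "?d \<le> mdist m (e q s) (e q z) + mdist m (e q z) (e q t)"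
        "mdist m (e q z) (e q t) \<le> mdist m (e q z) (e q p) + mdist m (e q p) (e q t)"
        "mdist m (e q p) (e q t) \<le> mdist m (e q p) (e q z') + mdist m (e q z') (e q t)"
        using M by (intro mdist_triangle; blast)+
      moreover have "mdist m (e q z) (e q p) = mdist m (e q p) (e q z)"
        "mdist m (e q z') (e q t) = mdist m (e q t) (e q z')" by (rule mdist_commute)+
      ultimately show False using z(2) z'(2) p n by linarith
    qed
    then have "disjnt (N q n z) (N q n z')" by (auto simp: N_def disjnt_iff)
    moreover have "s \<in> N q n z" "t \<in> N q n z'" using st z z' by (auto simp: N_def)
    moreover have "N q n z \<in> S" "N q n z' \<in> S" using q(1) z(1) z'(1) by (auto simp: S_def)
    ultimately show ?thesis by blast
  qed
  have local_base: "\<exists>b\<in>\<B>. s \<in> b \<and> b \<subseteq> U" if U: "openin T U" "s \<in> U" for U s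
  proof -
    have sT: "s \<in> topspace T" using U openin_subset by blast
    let ?C = "topspace T - U"
    have "\<forall>t\<in>?C. \<exists>a b. a \<in> S \<and> b \<in> S \<and> s \<in> a \<and> t \<in> b \<and> disjnt a b"
    proof
      fix t assume "t \<in> ?C"
      then show "\<exists>a b. a \<in> S \<and> b \<in> S \<and> s \<in> a \<and> t \<in> b \<and> disjnt a b"
        using separate[of s t] sT U(2) by blast
    qed
    then obtain a b where ab: "\<And>t. t \<in> ?C \<Longrightarrow> a t \<in> S" "\<And>t. t \<in> ?C \<Longrightarrow> b t \<in> S"
      "\<And>t. t \<in> ?C \<Longrightarrow> s \<in> a t" "\<And>t. t \<in> ?C \<Longrightarrow> t \<in> b t" "\<And>t. t \<in> ?C \<Longrightarrow> disjnt (a t) (b t)"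
      by metis
    \<comment> \<open>The set \<open>U\<close> together with the neighbourhoods \<open>b t\<close>
      of the points outside it covers the space. For a finite subcover, the intersection of the
      matching \<open>a t\<close> contains \<open>s\<close> and misses every \<open>b t\<close>
      used, so it lies in \<open>U\<close>.\<close>
    define c where "c t = (if t \<in> U then U else b t)" for t
    have "openin T (c t) \<and> t \<in> c t" if "t \<in> topspace T" for t
      using that U(1) ab(2,4)[of t] openS by (auto simp: c_def)
    then obtain I where I: "finite I" "I \<subseteq> topspace T" "topspace T \<subseteq> (\<Union>t\<in>I. c t)"
      by (rule compact_space_finite_cover[OF T])
    let ?b = "cap (a ` (I - U))"
    have "?b \<in> \<B>" unfolding \<B>_def using I ab(1) by (intro imageI) auto
    moreover have "s \<in> ?b" using sT ab(3) I(2) by (auto simp: cap_def)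
    moreover have "?b \<subseteq> U"
    proof
      fix p assume p: "p \<in> ?b"
      then obtain t where t: "t \<in> I" "p \<in> c t" using I(3) by (auto simp: cap_def)
      show "p \<in> U"
      proof (cases "t \<in> U")
        case False
        then have "p \<in> a t" "p \<in> b t" "t \<in> ?C" using p t I(2) by (auto simp: cap_def c_def)
        then show ?thesis using ab(5)[of t] by (auto simp: disjnt_iff)
      qed (use t in \<open>simp add: c_def\<close>)
    qed
    ultimately show ?thesis by blast
  qed
  have "is_base T \<B>"
    unfolding is_base_def
  proof (intro conjI ballI allI impI open\<B>)
    fix U assume "openin T U"
    then have "\<Union>{b \<in> \<B>. b \<subseteq> U} = U" using local_base by blast
    then show "\<exists>\<C>\<subseteq>\<B>. \<Union>\<C> = U" by (intro exI[of _ "{b \<in> \<B>. b \<subseteq> U}"]) auto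
  qed
  with card show ?thesis by blast
qed

text \<open>Separation of points survives the passage from all \<open>g x y\<close> to a uniformly
  dense set of them, so the base obtained has cardinality at most \<open>|V|\<close>, which is below
  the successor of \<open>|V|\<close>.\<close>

lemma weight_less_sharp_cellularity_if_separately_continuous:
  fixes g :: "'a \<Rightarrow> 'b \<Rightarrow> 'k \<Rightarrow> 'm" and m :: "'m metric"
  assumes X: "compact_space X" "Hausdorff_space X" "infinite (topspace X)" and Y: "compact_space Y"
    and T: "compact_space T"
    and gY: "\<And>x. x \<in> topspace X \<Longrightarrow> continuous_map Y (mtopology_of (cfunspace T m)) (g x)"
    and gX: "\<And>y. y \<in> topspace Y \<Longrightarrow> continuous_map X (mtopology_of (cfunspace T m)) (\<lambda>x. g x y)"
    and sep: "\<And>s t. s \<in> topspace T \<Longrightarrow> t \<in> topspace T \<Longrightarrow> s \<noteq> t \<Longrightarrow>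
      \<exists>x\<in>topspace X. \<exists>y\<in>topspace Y. g x y s \<noteq> g x y t"
  shows "weight_less_sharp_cellularity T X"
proof -
  obtain D V where D: "D \<subseteq> topspace X \<times> topspace Y" "|D| \<le>o |V|"
    and V: "disjoint_open_family X V" "infinite V"
    and dense: "\<And>x y e. x \<in> topspace X \<Longrightarrow> y \<in> topspace Y \<Longrightarrow> 0 < e \<Longrightarrow>
      \<exists>(a, b)\<in>D. mdist (cfunspace T m) (g x y) (g a b) < e"
    using dense_subset_below_sharp_cellularity[OF X Y gY gX] by blast
  have in_C: "g x y \<in> mspace (cfunspace T m)" if "x \<in> topspace X" "y \<in> topspace Y" for x y
    using continuous_map_funspace[OF gY[OF that(1)]] that(2)
    by (metis PiE topspace_mtopology_of)
  have in_m: "g x y s \<in> mspace m" if "x \<in> topspace X" "y \<in> topspace Y" "s \<in> topspace T" for x y s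
    using in_C[OF that(1,2)] that(3) by auto
  have "\<exists>\<B>. is_base T \<B> \<and> |\<B>| \<le>o |V|"
  proof (rule base_from_separating_family[OF T _ _ V(2) D(2)])
    show "continuous_map T (mtopology_of m) ((\<lambda>(a, b). g a b) q)" if "q \<in> D" for q
      using in_C that D(1) by (cases q) auto
    fix s t assume st: "s \<in> topspace T" "t \<in> topspace T" "s \<noteq> t"
    obtain x y where xy: "x \<in> topspace X" "y \<in> topspace Y" "g x y s \<noteq> g x y t" using sep[OF st] by blast
    let ?d = "mdist m (g x y s) (g x y t)"
    have "?d \<noteq> 0" using xy in_m st by simp
    \<comment> \<open>If \<open>g a b\<close> is uniformly within \<open>?d / 3\<close> of
      \<open>g x y\<close> and took equal values at \<open>s\<close> and \<open>t\<close>, then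
      \<open>?d\<close> would be at most \<open>2 * ?d / 3\<close>.\<close>
    then have pos: "0 < ?d / 3" using mdist_nonneg[of m "g x y s" "g x y t"] by linarith
    obtain a b where ab: "(a, b) \<in> D" "mdist (cfunspace T m) (g x y) (g a b) < ?d / 3"
      using dense[OF xy(1,2) pos] by blast
    have abXY: "a \<in> topspace X" "b \<in> topspace Y" using ab(1) D(1) by blast+
    have close: "mdist m (g x y u) (g a b u) \<le> ?d / 3" if "u \<in> topspace T" for u
      using mdist_cfunspace_imp_mdist_le[OF in_C[OF xy(1,2)] in_C[OF abXY] less_imp_le[OF ab(2)] that] .
    have "g a b s \<noteq> g a b t"
    proof
      assume eq: "g a b s = g a b t"
      have "?d \<le> mdist m (g x y s) (g a b s) + mdist m (g a b s) (g x y t)"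
        using in_m xy abXY st by (intro mdist_triangle) blast+
      also have "mdist m (g a b s) (g x y t) = mdist m (g x y t) (g a b t)"
        using eq mdist_commute by metis
      finally show False using close[OF st(1)] close[OF st(2)] pos by linarith
    qed
    then show "\<exists>q\<in>D. (\<lambda>(a, b). g a b) q s \<noteq> (\<lambda>(a, b). g a b) q t" using ab(1) by force
  qed
  then obtain \<B> where "is_base T \<B>" "|\<B>| \<le>o |V|" by blast
  moreover have "|\<B>| <o cardSuc |V|"
    using calculation(2) cardSuc_greater card_of_Card_order ordLeq_ordLess_trans by blast
  ultimately show ?thesis
    unfolding weight_less_sharp_cellularity_def less_sharp_cellularity_def using V(1)
    by (intro exI[of _ \<B>] exI[of _ V] conjI)
qed

subsection \<open>The cross-open topology\<close>

text \<open>The point is that \<open>U\<close> and \<open>V\<close> serve all \<open>t\<close> in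
  \<open>N\<close> at once; this is the source of equicontinuity. Subbasic sets involve closures, so
  regularity is used to fit closed neighbourhoods inside the preimages of \<open>W\<close> under
  \<open>s\<close>.\<close>

lemma cross_open_neighbourhood:
  assumes "regular_space X" "regular_space Y" and s: "s \<in> sep_cont X Y Z"
    and W: "openin Z W" and ab: "a \<in> topspace X" "b \<in> topspace Y" "s (a, b) \<in> W"
  obtains N U V where "openin (cross_open_topology X Y Z) N" "s \<in> N"
    "openin X U" "a \<in> U" "openin Y V" "b \<in> V"
    "\<And>t x. t \<in> N \<Longrightarrow> x \<in> U \<Longrightarrow> t (x, b) \<in> W" "\<And>t y. t \<in> N \<Longrightarrow> y \<in> V \<Longrightarrow> t (a, y) \<in> W"
proof -
  let ?U = "{x \<in> topspace X. s (x, b) \<in> W}" and ?V = "{y \<in> topspace Y. s (a, y) \<in> W}"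
  let ?XY = "prod_topology X Y" and ?C = "cross X Y (a, b)"
  have open_UV: "openin X ?U" "openin Y ?V"
    using s W ab by (auto simp: sep_cont_def intro: openin_continuous_map_preimage)
  obtain U U' where U: "openin X U" "closedin X U'" "a \<in> U" "U \<subseteq> U'" "U' \<subseteq> ?U"
    using assms(1) open_UV(1) ab
    by (metis (mono_tags, lifting) mem_Collect_eq neighbourhood_base_of neighbourhood_base_of_closedin)
  obtain V V' where V: "openin Y V" "closedin Y V'" "b \<in> V" "V \<subseteq> V'" "V' \<subseteq> ?V"
    using assms(2) open_UV(2) ab
    by (metis (mono_tags, lifting) mem_Collect_eq neighbourhood_base_of neighbourhood_base_of_closedin)
  define G where "G = ?C \<inter> (U \<times> V)"
  define A where "A = ?XY closure_of G \<inter> ?C"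
  have "openin (subtopology ?XY ?C) G"
    unfolding G_def using U V by (intro openin_subtopology_Int2) (simp add: openin_prod_Times_iff)
  have C: "?C \<subseteq> topspace ?XY" using ab by (auto simp: cross_def)
  have "G \<subseteq> A"
    using closure_of_subset[of G ?XY] C by (auto simp: A_def G_def)
  have "?XY closure_of G \<subseteq> U' \<times> V'"
    using U V by (intro closure_of_minimal) (auto simp: G_def closedin_prod_Times_iff)
  \<comment> \<open>A point of \<open>A\<close> lies on the cross and in
    \<open>U' \<times> V'\<close>, so it is \<open>(a, y)\<close> with \<open>y\<close> in
    \<open>V'\<close> or \<open>(x, b)\<close> with \<open>x\<close> in \<open>U'\<close>.\<close>
  then have "s ` A \<subseteq> W"
    using U(5) V(5) by (auto simp: A_def cross_def)
  let ?N = "{t \<in> sep_cont X Y Z. t ` A \<subseteq> W}"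
  show thesis
  proof
    show "openin (cross_open_topology X Y Z) ?N"
      unfolding cross_open_topology_def
    proof (rule topology_generated_by_Basis, intro CollectI exI conjI)
      show "(a, b) \<in> topspace X \<times> topspace Y" using ab by simp
      show "openin (subtopology ?XY ?C) G" by fact
      show "A = ?XY closure_of G \<inter> ?C" by (fact A_def)
    qed (use W in auto)
    show "s \<in> ?N" using s \<open>s ` A \<subseteq> W\<close> by simp
    show "t (x, b) \<in> W" if t: "t \<in> ?N" and x: "x \<in> U" for t x
    proof -
      have "(x, b) \<in> A" using x V(3) openin_subset[OF U(1)] \<open>G \<subseteq> A\<close> by (auto simp: G_def cross_def)
      then show ?thesis using t by blast
    qed
    show "t (a, y) \<in> W" if t: "t \<in> ?N" and y: "y \<in> V" for t y
    proof -
      have "(a, y) \<in> A" using y U(3) openin_subset[OF V(1)] \<open>G \<subseteq> A\<close> by (auto simp: G_def cross_def)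
      then show ?thesis using t by blast
    qed
  qed (fact U V)+
qed

lemma continuous_map_evaluation_cross_open:
  assumes "regular_space X" "regular_space Y" "K \<subseteq> sep_cont X Y Z"
    and "a \<in> topspace X" "b \<in> topspace Y"
  shows "continuous_map (subtopology (cross_open_topology X Y Z) K) Z (\<lambda>s. s (a, b))"
  unfolding continuous_map_eq_topcontinuous_at topcontinuous_at_def
proof (intro ballI conjI allI impI)
  let ?T = "subtopology (cross_open_topology X Y Z) K"
  show "(\<lambda>s. s (a, b)) \<in> topspace ?T \<rightarrow> topspace Z"
    using assms(3-5) by (fastforce simp: sep_cont_def continuous_map_def Pi_iff)
  fix s W assume s: "s \<in> topspace ?T" and W: "openin Z W \<and> s (a, b) \<in> W"
  have "s \<in> sep_cont X Y Z" using s assms(3) by auto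
  then obtain N U V where N: "openin (cross_open_topology X Y Z) N" "s \<in> N" "a \<in> U"
      "\<And>t x. t \<in> N \<Longrightarrow> x \<in> U \<Longrightarrow> t (x, b) \<in> W"
    using cross_open_neighbourhood[OF assms(1,2), of s Z W a b] W assms(4,5) by metis
  then have "openin ?T (K \<inter> N)" "s \<in> K \<inter> N" "\<forall>t\<in>K \<inter> N. t (a, b) \<in> W"
    using s by (auto intro: openin_subtopology_Int2)
  then show "\<exists>U. openin ?T U \<and> s \<in> U \<and> (\<forall>t\<in>U. t (a, b) \<in> W)" by blast
qed (use assms in auto)

text \<open>Finitely many of the neighbourhoods \<open>N s\<close> cover \<open>K\<close>, and the
  intersections of the corresponding \<open>U s\<close> and \<open>V s\<close> work for every
  \<open>t\<close>. The radius \<open>e / 2\<close> is chosen because both values of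
  \<open>t\<close> are compared with \<open>s (a, b)\<close>.\<close>

lemma equicontinuous_on_cross:
  assumes "regular_space X" "regular_space Y" and K: "K \<subseteq> sep_cont X Y (mtopology_of m)"
    and T: "compact_space (subtopology (cross_open_topology X Y (mtopology_of m)) K)"
      "topspace (subtopology (cross_open_topology X Y (mtopology_of m)) K) = K"
    and ab: "a \<in> topspace X" "b \<in> topspace Y" and "0 < e"
  obtains U V where "openin X U" "a \<in> U" "openin Y V" "b \<in> V"
    "\<And>t x. t \<in> K \<Longrightarrow> x \<in> U \<Longrightarrow> mdist m (t (a, b)) (t (x, b)) < e"
    "\<And>t y. t \<in> K \<Longrightarrow> y \<in> V \<Longrightarrow> mdist m (t (a, b)) (t (a, y)) < e"
proof -
  let ?S = "cross_open_topology X Y (mtopology_of m)"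
  let ?T = "subtopology ?S K"
  have in_m: "s (a, b) \<in> mspace m" if "s \<in> K" for s
    using K that ab by (fastforce simp: sep_cont_def continuous_map_def Pi_iff)
  define near where "near s N U V \<longleftrightarrow> openin ?S N \<and> s \<in> N \<and> openin X U \<and> a \<in> U \<and> openin Y V \<and> b \<in> V \<and>
      (\<forall>t\<in>N. (\<forall>x\<in>U. t (x, b) \<in> mball_of m (s (a, b)) (e / 2)) \<and>
        (\<forall>y\<in>V. t (a, y) \<in> mball_of m (s (a, b)) (e / 2)))" for s N U V
  have "\<exists>N U V. near s N U V" if s: "s \<in> K" for s
  proof -
    have W: "openin (mtopology_of m) (mball_of m (s (a, b)) (e / 2))"
      by (simp add: Metric_space.openin_mball mball_of_def mtopology_of_def)
    have "s \<in> sep_cont X Y (mtopology_of m)" "s (a, b) \<in> mball_of m (s (a, b)) (e / 2)"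
      using in_m[OF s] \<open>0 < e\<close> K s by (auto simp: mdist_self)
    then obtain N U V where h: "openin ?S N" "s \<in> N" "openin X U" "a \<in> U" "openin Y V" "b \<in> V"
      "\<And>t x. t \<in> N \<Longrightarrow> x \<in> U \<Longrightarrow> t (x, b) \<in> mball_of m (s (a, b)) (e / 2)"
      "\<And>t y. t \<in> N \<Longrightarrow> y \<in> V \<Longrightarrow> t (a, y) \<in> mball_of m (s (a, b)) (e / 2)"
      using cross_open_neighbourhood[OF assms(1,2) _ W ab, of s] by metis
    then show ?thesis
      unfolding near_def by (intro exI[of _ N] exI[of _ U] exI[of _ V] conjI ballI h)
  qed
  then obtain N U V where "\<And>s. s \<in> K \<Longrightarrow> near s (N s) (U s) (V s)" by metis
  then have N: "\<And>s. s \<in> K \<Longrightarrow> openin ?S (N s) \<and> s \<in> N s"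
    and U: "\<And>s. s \<in> K \<Longrightarrow> openin X (U s) \<and> a \<in> U s"
    and V: "\<And>s. s \<in> K \<Longrightarrow> openin Y (V s) \<and> b \<in> V s"
    and NU: "\<And>s t x. s \<in> K \<Longrightarrow> t \<in> N s \<Longrightarrow> x \<in> U s \<Longrightarrow> t (x, b) \<in> mball_of m (s (a, b)) (e / 2)"
    and NV: "\<And>s t y. s \<in> K \<Longrightarrow> t \<in> N s \<Longrightarrow> y \<in> V s \<Longrightarrow> t (a, y) \<in> mball_of m (s (a, b)) (e / 2)"
    unfolding near_def by blast+
  have "openin ?T (K \<inter> N s) \<and> s \<in> K \<inter> N s" if "s \<in> topspace ?T" for s
    using N[of s] that by (auto intro: openin_subtopology_Int2)
  then obtain F where F: "finite F" "F \<subseteq> K" "K \<subseteq> (\<Union>s\<in>F. K \<inter> N s)"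
    using compact_space_finite_cover[OF T(1)] T(2) by metis
  have close: "mdist m (t (a, b)) (t p) < e" if "s \<in> K" "t \<in> N s"
    "t p \<in> mball_of m (s (a, b)) (e / 2)" for s t p
  proof -
    have "t (a, b) \<in> mball_of m (s (a, b)) (e / 2)" using NU U that by blast
    moreover have "mdist m (t (a, b)) (t p) \<le> mdist m (t (a, b)) (s (a, b)) + mdist m (s (a, b)) (t p)"
      using that(3) calculation by (intro mdist_triangle) auto
    ultimately show ?thesis using that(3) by (auto simp: mdist_commute[of m "t (a, b)" "s (a, b)"])
  qed
  show thesis
  proof
    \<comment> \<open>The factors \<open>topspace X\<close> and \<open>topspace Y\<close> take care
      of an empty \<open>F\<close>, which occurs when \<open>K\<close> is empty.\<close>
    show "openin X (topspace X \<inter> \<Inter> (U ` F))" "openin Y (topspace Y \<inter> \<Inter> (V ` F))"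
      using F U V by (auto intro!: openin_Int_Inter)
    show "a \<in> topspace X \<inter> \<Inter> (U ` F)" "b \<in> topspace Y \<inter> \<Inter> (V ` F)" using ab F(2) U V by auto
    show "mdist m (t (a, b)) (t (x, b)) < e" if t: "t \<in> K" and x: "x \<in> topspace X \<inter> \<Inter> (U ` F)" for t x
    proof -
      obtain s where "s \<in> F" "t \<in> N s" using F(3) t by blast
      then show ?thesis using close[of s t "(x, b)"] NU[of s t x] x F(2) by blast
    qed
    show "mdist m (t (a, b)) (t (a, y)) < e" if t: "t \<in> K" and y: "y \<in> topspace Y \<inter> \<Inter> (V ` F)" for t y
    proof -
      obtain s where "s \<in> F" "t \<in> N s" using F(3) t by blast
      then show ?thesis using close[of s t "(a, y)"] NV[of s t y] y F(2) by blast
    qed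
  qed
qed

section \<open>Passage to the uniform metric and conclusion\<close>

text \<open>Equicontinuity at \<open>b\<close>, uniform in \<open>t\<close>, is continuity for the
  supremum metric. Compactness of \<open>T\<close> gives the boundedness that membership in
  \<open>cfunspace\<close> requires, and \<open>restrict\<close> gives extensionality. Pointwise
  strict bounds yield only a non-strict bound on the supremum, hence \<open>e / 2\<close> in the
  proof.\<close>

lemma continuous_map_into_cfunspace:
  assumes T: "compact_space T"
    and f: "\<And>y. y \<in> topspace Y \<Longrightarrow> continuous_map T (mtopology_of m) (f y)"
    and equi: "\<And>b e. b \<in> topspace Y \<Longrightarrow> 0 < e \<Longrightarrow>
      \<exists>V. openin Y V \<and> b \<in> V \<and> (\<forall>y\<in>V. \<forall>t\<in>topspace T. mdist m (f b t) (f y t) < e)"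
  shows "continuous_map Y (mtopology_of (cfunspace T m)) (\<lambda>y. restrict (f y) (topspace T))"
proof -
  have mem: "restrict (f y) (topspace T) \<in> mspace (cfunspace T m)" if "y \<in> topspace Y" for y
  proof -
    have "continuous_map T (mtopology_of m) (restrict (f y) (topspace T))"
      by (rule continuous_map_eq[OF f[OF that]]) simp
    moreover have "f y t \<in> mspace m" if "t \<in> topspace T" for t
      using continuous_map_funspace[OF f[OF \<open>y \<in> topspace Y\<close>]] that by auto
    ultimately show ?thesis
      using T unfolding compactin_mspace_cfunspace[OF T[unfolded compact_space_def]] by simp
  qed
  show ?thesis
    unfolding mtopology_of_def Metric_space.continuous_map_to_metric[OF Metric_space_mspace_mdist]
      Metric_space.in_mball[OF Metric_space_mspace_mdist]
  proof (intro ballI allI impI)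
    fix b and e :: real assume b: "b \<in> topspace Y" and "0 < e"
    then obtain V where V: "openin Y V" "b \<in> V"
        "\<And>y t. y \<in> V \<Longrightarrow> t \<in> topspace T \<Longrightarrow> mdist m (f b t) (f y t) < e / 2"
      using equi[of b "e / 2"] by auto
    have "mdist (cfunspace T m) (restrict (f b) (topspace T)) (restrict (f y) (topspace T)) < e"
      if "y \<in> V" for y
    proof -
      have "mdist (cfunspace T m) (restrict (f b) (topspace T)) (restrict (f y) (topspace T)) \<le> e / 2"
        by (rule mdist_cfunspace_le) (use V(3)[OF that] \<open>0 < e\<close> in \<open>auto simp: less_imp_le\<close>)
      then show ?thesis using \<open>0 < e\<close> by linarith
    qed
    then show "\<exists>V. openin Y V \<and> b \<in> V \<and> (\<forall>y\<in>V.
        restrict (f b) (topspace T) \<in> mspace (cfunspace T m) \<and>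
        restrict (f y) (topspace T) \<in> mspace (cfunspace T m) \<and>
        mdist (cfunspace T m) (restrict (f b) (topspace T)) (restrict (f y) (topspace T)) < e)"
      using V(1,2) mem b openin_subset[OF V(1)] by (intro exI[of _ V]) blast
  qed
qed

theorem theorem6p2:
  fixes X :: "'a topology" and Y :: "'b topology" and Z :: "'c topology"
    and K :: "('a \<times> 'b \<Rightarrow> 'c) set"
  assumes "compact_space X" "Hausdorff_space X" "infinite (topspace X)"
    and "compact_space Y" "Hausdorff_space Y" "infinite (topspace Y)"
    and "metrizable_space Z"
    and "K \<subseteq> sep_cont X Y Z"
    and "compactin (cross_open_topology X Y Z) K"
  shows "weight_less_sharp_cellularity (subtopology (cross_open_topology X Y Z) K) X
       \<and> weight_less_sharp_cellularity (subtopology (cross_open_topology X Y Z) K) Y"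
proof -
  obtain M d where "Metric_space M d" "Z = Metric_space.mtopology M d"
    using assms(7) by (auto simp: metrizable_space_def)
  then have "Z = mtopology_of (metric (M, d))"
    by (simp add: mtopology_of_def Metric_space.mspace_metric Metric_space.mdist_metric)
  then obtain m where Z: "Z = mtopology_of m" by blast
  let ?T = "subtopology (cross_open_topology X Y Z) K"
  have T: "compact_space ?T" "topspace ?T = K"
    using assms(9) by (auto simp: compactin_subspace)
  have reg: "regular_space X" "regular_space Y"
    using assms compact_Hausdorff_imp_regular_space by blast+
  \<comment> \<open>Evaluation at \<open>(x, y)\<close>, regarded as a point of the space of
    continuous functions on \<open>K\<close>.\<close>
  define g where "g x y = restrict (\<lambda>s. s (x, y)) K" for x y
  have eval: "continuous_map ?T (mtopology_of m) (\<lambda>s. s (x, y))"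
    if "x \<in> topspace X" "y \<in> topspace Y" for x y
    using continuous_map_evaluation_cross_open[OF reg assms(8) that] Z by simp
  have equi: "\<exists>U V. openin X U \<and> a \<in> U \<and> openin Y V \<and> b \<in> V \<and>
      (\<forall>x\<in>U. \<forall>t\<in>K. mdist m (t (a, b)) (t (x, b)) < e) \<and>
      (\<forall>y\<in>V. \<forall>t\<in>K. mdist m (t (a, b)) (t (a, y)) < e)"
    if "a \<in> topspace X" "b \<in> topspace Y" "0 < e" for a b e
    by (rule equicontinuous_on_cross[OF reg assms(8)[unfolded Z] T[unfolded Z] that]) blast
  have gY: "continuous_map Y (mtopology_of (cfunspace ?T m)) (g x)" if x: "x \<in> topspace X" for x
  proof -
    have "continuous_map Y (mtopology_of (cfunspace ?T m)) (\<lambda>y. restrict (\<lambda>s. s (x, y)) (topspace ?T))"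
    proof (rule continuous_map_into_cfunspace[OF T(1) eval[OF x]])
      fix b and e :: real assume "b \<in> topspace Y" "0 < e"
      from equi[OF x this] show "\<exists>V. openin Y V \<and> b \<in> V \<and>
          (\<forall>y\<in>V. \<forall>t\<in>topspace ?T. mdist m (t (x, b)) (t (x, y)) < e)"
        unfolding T(2) by (elim exE conjE) (intro exI conjI)
    qed
    then show ?thesis unfolding T(2) g_def[abs_def] .
  qed
  have gX: "continuous_map X (mtopology_of (cfunspace ?T m)) (\<lambda>x. g x y)" if y: "y \<in> topspace Y" for y
  proof -
    have "continuous_map X (mtopology_of (cfunspace ?T m)) (\<lambda>x. restrict (\<lambda>s. s (x, y)) (topspace ?T))"
    proof (rule continuous_map_into_cfunspace[OF T(1) eval[OF _ y]])
      fix a and e :: real assume "a \<in> topspace X" "0 < e"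
      from equi[OF this(1) y this(2)] show "\<exists>U. openin X U \<and> a \<in> U \<and>
          (\<forall>x\<in>U. \<forall>t\<in>topspace ?T. mdist m (t (a, y)) (t (x, y)) < e)"
        unfolding T(2) by (elim exE conjE) (intro exI conjI)
    qed
    then show ?thesis unfolding T(2) g_def[abs_def] .
  qed
  have sep: "\<exists>x\<in>topspace X. \<exists>y\<in>topspace Y. g x y s \<noteq> g x y t"
    if st: "s \<in> topspace ?T" "t \<in> topspace ?T" "s \<noteq> t" for s t
  proof -
    have K: "s \<in> K" "t \<in> K" using st T(2) by auto
    then have "s \<in> extensional (topspace X \<times> topspace Y)" "t \<in> extensional (topspace X \<times> topspace Y)"
      using assms(8) by (auto simp: sep_cont_def)
    \<comment> \<open>Members of \<open>sep_cont\<close> are extensional, so distinct ones differ at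
      a point of the product and not merely outside it.\<close>
    then obtain p where "p \<in> topspace X \<times> topspace Y" "s p \<noteq> t p"
      using st(3) extensionalityI by blast
    then show ?thesis using K by (force simp: g_def)
  qed
  have "weight_less_sharp_cellularity ?T X"
    by (rule weight_less_sharp_cellularity_if_separately_continuous[OF assms(1-4) T(1) gY gX sep])
  \<comment> \<open>Separate continuity of \<open>g\<close> is symmetric, so the same lemma applies
    with the two arguments exchanged.\<close>
  moreover have "weight_less_sharp_cellularity ?T Y"
    by (rule weight_less_sharp_cellularity_if_separately_continuous[OF assms(4-6,1) T(1), of m "\<lambda>y x. g x y"])
      (use gY gX sep in blast)+
  ultimately show ?thesis by blast
qed

end
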